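(* Assume that $\widehat W$ is convex in $C$ and that $\varphi_0$ is a weak solution of the corresponding Euler-Lagrange equation $\operatorname{Div}S_1(\nabla\varphi)=0$. If the second Piola-Kirchhoff stress tensor $S_2(C_0)=2\,D_C\widehat W(C_0)$ corresponding to $C_0=\nabla\varphi_0^T\nabla\varphi_0$ is positive definite everywhere in $\Omega$, then this solution $\varphi_0$ is a global minimizer (of the elastic energy $I$ subject to the given boundary condition).
   Context: Let $\mathrm{Sym}_+(3)$ denote the set of positive definite symmetric real $3\times3$ matrices and let $\langle X,Y\rangle=\operatorname{tr}(Y^TX)$ be the canonical inner product on $\mathbb{R}^{3\times3}$. Consider the problem of minimizing the elastic energy $I(\varphi)=\int_\Omega W(\nabla\varphi)\,dx$, where $\varphi\colon\Omega\to\mathbb{R}^3$ is the deformation of an elastic body $\Omega\subset\mathbb{R}^3$, subject to the boundary condition $\varphi|_\Gamma=\phi_0$ with $\Gamma\subset\partial\Omega$ and given boundary data $\phi_0$ (not to be confused with the deformation $\varphi_0$ in the claim). Here $F=\nabla\varphi$ is the gradient of deformation, $C=F^TF$ is the right Cauchy-Green tensor, and the energy density has the form $W(F)=\widehat W(F^TF)=\widehat W(C)$, with $\widehat W$ a real-valued function of $C\in\mathrm{Sym}_+(3)$; convexity in $C$ means convexity of $\widehat W$ on $\mathrm{Sym}_+(3)$. The corresponding formal Euler-Lagrange equation is $0=\operatorname{Div}D_FW(F)=\operatorname{Div}S_1(F)$, where $S_1(F)=D_FW(F)=F\,S_2(F^TF)$ is the first Piola-Kirchhoff stress tensor and $S_2(C)=2\,D_C\widehat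 W(C)$ is the second Piola-Kirchhoff stress tensor. That $\varphi_0$ is a weak solution means that it satisfies the boundary condition and the weak form $\int_\Omega\langle S_1(\nabla\varphi_0),\nabla u\rangle\,dx=0$ of this equation for the variations $u=\varphi-\varphi_0$, where $\varphi$ is any competing deformation satisfying the same boundary condition. *)

theory Defs
  imports "HOL-Analysis.Analysis"
begin

type_synonym vec3 = "real ^ 3"
type_synonym mat3 = "real ^ 3 ^ 3"

text \<open>The library inner product on matrices is the canonical one.\<close>

lemma inner_eq_trace: "(X :: mat3) \<bullet> Y = trace (transpose Y ** X)"
  unfolding trace_def transpose_def matrix_matrix_mult_def inner_vec_def
  by (simp add: mult.commute) (rule sum.swap)

definition Sym :: "mat3 set" where
  "Sym = {C. transpose C = C}"

definition Sym_pos :: "mat3 set" where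
  "Sym_pos = {C \<in> Sym. \<forall>v. v \<noteq> 0 \<longrightarrow> v \<bullet> (C *v v) > 0}"


section \<open>Energy density and stress tensors\<close>

definition cauchy_green :: "mat3 \<Rightarrow> mat3" where
  "cauchy_green F = transpose F ** F"

text \<open>The energy density as a function of \<open>F\<close>. Values of \<open>What\<close> outside \<^const>\<open>Sym_pos\<close>
  are irrelevant, so \<open>W\<close> is meaningful for invertible \<open>F\<close> only.\<close>

definition W_of :: "(mat3 \<Rightarrow> real) \<Rightarrow> mat3 \<Rightarrow> real" where
  "W_of What F = What (cauchy_green F)"

definition D_F :: "(mat3 \<Rightarrow> real) \<Rightarrow> mat3 \<Rightarrow> mat3" where
  "D_F W F = (SOME S. (W has_derivative (\<lambda>H. S \<bullet> H)) (at F))"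

text \<open>\<^const>\<open>Sym_pos\<close> is open in the six-dimensional space \<^const>\<open>Sym\<close>, but not in the space of
  all matrices. Differentiation with respect to \<open>C\<close> is therefore taken within \<^const>\<open>Sym_pos\<close>, and
  the gradient is the unique representative of the derivative lying in \<^const>\<open>Sym\<close>.\<close>

definition D_C :: "(mat3 \<Rightarrow> real) \<Rightarrow> mat3 \<Rightarrow> mat3" where
  "D_C What C =
     (SOME S. S \<in> Sym \<and> (What has_derivative (\<lambda>H. S \<bullet> H)) (at C within Sym_pos))"

definition piola1 :: "(mat3 \<Rightarrow> real) \<Rightarrow> mat3 \<Rightarrow> mat3" where
  "piola1 What F = D_F (W_of What) F"

definition piola2 :: "(mat3 \<Rightarrow> real) \<Rightarrow> mat3 \<Rightarrow> mat3" where
  "piola2 What C = 2 *\<^sub>R D_C What C"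


section \<open>Weak gradients\<close>

definition test_function :: "vec3 set \<Rightarrow> (vec3 \<Rightarrow> real) \<Rightarrow> (vec3 \<Rightarrow> vec3) \<Rightarrow> bool" where
  "test_function \<Omega> \<psi> D\<psi> \<longleftrightarrow>
     (\<forall>x. (\<psi> has_derivative (\<lambda>h. D\<psi> x \<bullet> h)) (at x)) \<and> continuous_on UNIV D\<psi> \<and>
     compact (closure {x. \<psi> x \<noteq> 0}) \<and> closure {x. \<psi> x \<noteq> 0} \<subseteq> \<Omega>"

text \<open>The usual weak derivative of locally integrable maps, tested with compactly supported
  functions of class \<open>C\<^sup>1\<close> as in Evans and Gariepy; by mollification, smooth test functions give the
  same notion. Row \<open>i\<close> of the gradient belongs to the component \<open>\<phi>\<^sub>i\<close>.\<close>

definition has_weak_gradient ::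
    "vec3 set \<Rightarrow> (vec3 \<Rightarrow> vec3) \<Rightarrow> (vec3 \<Rightarrow> mat3) \<Rightarrow> bool" where
  "has_weak_gradient \<Omega> \<phi> G \<longleftrightarrow>
     (\<forall>K. compact K \<and> K \<subseteq> \<Omega> \<longrightarrow> set_integrable lebesgue K \<phi> \<and> set_integrable lebesgue K G) \<and>
     (\<forall>\<psi> D\<psi>. test_function \<Omega> \<psi> D\<psi> \<longrightarrow>
        (\<forall>i j. (LINT x:\<Omega>|lebesgue. \<phi> x $ i * D\<psi> x $ j)
              = - (LINT x:\<Omega>|lebesgue. G x $ i $ j * \<psi> x)))"

text \<open>Weak gradients are unique only up to null sets; this picks a representative, so pointwise
  statements about \<open>wgrad\<close> are to be made almost everywhere.\<close>

definition wgrad :: "vec3 set \<Rightarrow> (vec3 \<Rightarrow> vec3) \<Rightarrow> vec3 \<Rightarrow> mat3" where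
  "wgrad \<Omega> \<phi> = (SOME G. has_weak_gradient \<Omega> \<phi> G)"


section \<open>Boundary condition\<close>

text \<open>Sets of two-dimensional Hausdorff measure zero. For null sets no upper bound on the
  diameters of the covering sets is needed.\<close>

definition hausdorff2_null :: "vec3 set \<Rightarrow> bool" where
  "hausdorff2_null N \<longleftrightarrow>
     (\<forall>\<epsilon>>0. \<exists>U :: nat \<Rightarrow> vec3 set. N \<subseteq> (\<Union>i. U i) \<and> (\<forall>i. bounded (U i)) \<and>
        summable (\<lambda>i. (diameter (U i))\<^sup>2) \<and> (\<Sum>i. (diameter (U i))\<^sup>2) < \<epsilon>)"

text \<open>\<open>\<phi> = g\<close> on \<open>\<Gamma>\<close> in the sense of traces: up to a set of surface measure zero, the mean of
  \<open>\<bar>\<phi> - g(x)\<bar>\<close> over the part of a ball around \<open>x\<close> inside \<open>\<Omega>\<close> vanishes as the radius shrinks. On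
  bounded Lipschitz domains this characterizes the trace of Sobolev maps (Evans and Gariepy), and
  it holds whenever \<open>\<phi>\<close> extends continuously to \<open>\<Omega> \<union> \<Gamma>\<close> with boundary values \<open>g\<close>.\<close>

definition boundary_values ::
    "vec3 set \<Rightarrow> vec3 set \<Rightarrow> (vec3 \<Rightarrow> vec3) \<Rightarrow> (vec3 \<Rightarrow> vec3) \<Rightarrow> bool" where
  "boundary_values \<Omega> \<Gamma> \<phi> g \<longleftrightarrow>
     (\<exists>N. hausdorff2_null N \<and>
       (\<forall>x\<in>\<Gamma> - N.
          ((\<lambda>r. (\<integral>\<^sup>+y\<in>ball x r \<inter> \<Omega>. ennreal (norm (\<phi> y - g x)) \<partial>lebesgue)
                 / emeasure lebesgue (ball x r \<inter> \<Omega>)) \<longlongrightarrow> 0) (at_right 0)))"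


section \<open>The minimization problem\<close>

text \<open>A deformation has a weak gradient whose Cauchy-Green tensor lies in the domain
  \<^const>\<open>Sym_pos\<close> of the energy.\<close>

definition deformation :: "vec3 set \<Rightarrow> (vec3 \<Rightarrow> vec3) \<Rightarrow> bool" where
  "deformation \<Omega> \<phi> \<longleftrightarrow> (\<exists>G. has_weak_gradient \<Omega> \<phi> G) \<and>
     (AE x in lebesgue. x \<in> \<Omega> \<longrightarrow> cauchy_green (wgrad \<Omega> \<phi> x) \<in> Sym_pos)"

text \<open>The set \<open>V\<close> is the function class in which the problem is posed, for instance the maps of
  class \<open>C\<^sup>1\<close>, those in some Sobolev space \<open>W\<^sup>1\<^sup>,\<^sup>p\<close>, those preserving orientation, or \<^term>\<open>UNIV\<close>.\<close>

definition competing ::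
    "(vec3 \<Rightarrow> vec3) set \<Rightarrow> vec3 set \<Rightarrow> vec3 set \<Rightarrow> (vec3 \<Rightarrow> vec3) \<Rightarrow> (vec3 \<Rightarrow> vec3) set" where
  "competing V \<Omega> \<Gamma> g = {\<phi> \<in> V. deformation \<Omega> \<phi> \<and> boundary_values \<Omega> \<Gamma> \<phi> g}"

text \<open>The Lebesgue integral with values in the extended reals, as the integral of the positive part
  minus that of the negative part (\<^const>\<open>ennreal\<close> truncates at 0). If both are infinite the
  energy is \<open>\<infinity>\<close>, because \<open>\<infinity> - \<infinity> = \<infinity>\<close> in \<^typ>\<open>ereal\<close>.\<close>

definition energy :: "(mat3 \<Rightarrow> real) \<Rightarrow> vec3 set \<Rightarrow> (vec3 \<Rightarrow> vec3) \<Rightarrow> ereal" where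
  "energy What \<Omega> \<phi> =
     enn2ereal (\<integral>\<^sup>+x\<in>\<Omega>. ennreal (W_of What (wgrad \<Omega> \<phi> x)) \<partial>lebesgue) -
     enn2ereal (\<integral>\<^sup>+x\<in>\<Omega>. ennreal (- W_of What (wgrad \<Omega> \<phi> x)) \<partial>lebesgue)"

text \<open>Integrability is part of the weak equation, since the Bochner integral of a non-integrable
  function is 0 by convention.\<close>

definition weak_solution ::
    "(mat3 \<Rightarrow> real) \<Rightarrow> (vec3 \<Rightarrow> vec3) set \<Rightarrow> vec3 set \<Rightarrow> vec3 set \<Rightarrow> (vec3 \<Rightarrow> vec3)
      \<Rightarrow> (vec3 \<Rightarrow> vec3) \<Rightarrow> bool" where
  "weak_solution What V \<Omega> \<Gamma> g \<phi>\<^sub>0 \<longleftrightarrow>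
     \<phi>\<^sub>0 \<in> competing V \<Omega> \<Gamma> g \<and>
     (\<forall>\<phi>\<in>competing V \<Omega> \<Gamma> g.
        let u = (\<lambda>x. \<phi> x - \<phi>\<^sub>0 x) in
        set_integrable lebesgue \<Omega> (\<lambda>x. piola1 What (wgrad \<Omega> \<phi>\<^sub>0 x) \<bullet> wgrad \<Omega> u x) \<and>
        (LINT x:\<Omega>|lebesgue. piola1 What (wgrad \<Omega> \<phi>\<^sub>0 x) \<bullet> wgrad \<Omega> u x) = 0)"

definition global_minimizer ::
    "(mat3 \<Rightarrow> real) \<Rightarrow> (vec3 \<Rightarrow> vec3) set \<Rightarrow> vec3 set \<Rightarrow> vec3 set \<Rightarrow> (vec3 \<Rightarrow> vec3)
      \<Rightarrow> (vec3 \<Rightarrow> vec3) \<Rightarrow> bool" where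
  "global_minimizer What V \<Omega> \<Gamma> g \<phi>\<^sub>0 \<longleftrightarrow>
     \<phi>\<^sub>0 \<in> competing V \<Omega> \<Gamma> g \<and>
     (\<forall>\<phi>\<in>competing V \<Omega> \<Gamma> g. energy What \<Omega> \<phi>\<^sub>0 \<le> energy What \<Omega> \<phi>)"

end

theory Submission
  imports Defs "HOL-Real_Asymp.Real_Asymp"
begin

text \<open>Write \<open>F\<^sub>0\<close> and \<open>F\<close> for the gradients of the weak solution and of a competitor,
  \<open>H = F - F\<^sub>0\<close>, and \<open>C\<^sub>0\<close>, \<open>C\<close> for the Cauchy-Green tensors. Convexity in \<open>C\<close> puts the energy density
  above its tangent, \<open>What C \<ge> What C\<^sub>0 + 1/2 S\<^sub>2(C\<^sub>0) \<bullet> (C - C\<^sub>0)\<close>. Here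
  \<open>C - C\<^sub>0 = H\<^sup>T F\<^sub>0 + F\<^sub>0\<^sup>T H + H\<^sup>T H\<close>. By symmetry of \<open>S\<^sub>2\<close> the part linear in \<open>H\<close> contributes exactly
  \<open>(F\<^sub>0 S\<^sub>2) \<bullet> H = S\<^sub>1(F\<^sub>0) \<bullet> H\<close>, and the quadratic part contributes \<open>1/2 S\<^sub>2 \<bullet> (H\<^sup>T H)\<close>, which is
  nonnegative because \<open>S\<^sub>2\<close> is positive definite. Hence, pointwise almost everywhere,
  \<open>W F \<ge> W F\<^sub>0 + S\<^sub>1(F\<^sub>0) \<bullet> H\<close> (lemma \<open>W_of_above_tangent\<close>), although \<open>W\<close> itself need not be convex in
  \<open>F\<close>. The integral of the linear term vanishes by the weak equation, so the energies compare.

  Two points need care. The weak equation speaks of the weak gradient of the difference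
  \<open>u = \<phi> - \<phi>\<^sub>0\<close>, whereas the pointwise inequality has the difference of the weak gradients. These agree
  almost everywhere because weak gradients are unique up to null sets (lemma \<open>wgrad_diff\<close>), which
  follows from the fundamental lemma of the calculus of variations. A Dynkin argument proves the
  latter: the sets \<open>{g > 0}\<close> with \<open>g \<ge> 0\<close> of class C1 are closed under intersection and generate the Borel sets, and
  the functions \<open>n g / (1 + n g)\<close> converge to the indicator of such a set, and are test functions if
  its closure is a compact subset of \<open>\<Omega>\<close>.

  Moreover, the energies may be infinite, so the pointwise inequality cannot simply be integrated as
  an inequality between integrable functions. It is split into positive and negative parts in such a
  way that only nonnegative functions are integrated (lemma \<open>extended_integral_mono\<close>).\<close>

section \<open>Algebra of the Cauchy-Green tensor\<close>

lemma matrix_inner_transpose: "transpose X \<bullet> transpose (Y :: mat3) = X \<bullet> Y"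
  by (simp add: inner_vec_def transpose_def) (rule sum.swap)

text \<open>Both sides are the trace of \<open>B\<^sup>T A S\<close>. This moves a factor of the argument over to the stress: it
  turns \<open>S \<bullet> (F\<^sup>T H)\<close> into \<open>(F S) \<bullet> H\<close>, that is, a second Piola-Kirchhoff stress into a first one.\<close>

lemma inner_transpose_mult: "(S :: mat3) \<bullet> (transpose A ** B) = (A ** S) \<bullet> (B :: mat3)"
  by (simp add: inner_eq_trace matrix_transpose_mul matrix_mul_assoc)

lemma inner_sym_transpose_mult:
  assumes "S \<in> Sym"
  shows "S \<bullet> (transpose A ** B) = S \<bullet> (transpose B ** A)"
  using matrix_inner_transpose[of S "transpose A ** B"] assms
  by (simp add: Sym_def matrix_transpose_mul)

lemma bounded_bilinear_matrix_mult: "bounded_bilinear (\<lambda>(X :: mat3) (Y :: mat3). X ** Y)"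
proof -
  have "bilinear (\<lambda>(X :: mat3) (Y :: mat3). X ** Y)"
    unfolding bilinear_def
    by (auto intro!: linearI simp: matrix_matrix_mult_def vec_eq_iff sum.distrib algebra_simps
        sum_distrib_left)
  then show ?thesis
    by (simp add: bilinear_conv_bounded_bilinear)
qed

lemma cauchy_green_diff:
  "cauchy_green F - cauchy_green F0
     = (transpose (F - F0) ** F0 + transpose F0 ** (F - F0)) + transpose (F - F0) ** (F - F0)"
proof -
  have "transpose (F - F0) = transpose F - transpose F0"
    by (simp add: transpose_def vec_eq_iff)
  then show ?thesis
    by (simp add: cauchy_green_def bounded_bilinear.diff_left[OF bounded_bilinear_matrix_mult]
        bounded_bilinear.diff_right[OF bounded_bilinear_matrix_mult])
qed

text \<open>The two terms of the difference that are linear in \<open>F - F0\<close> are transposes of each other, so a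
  symmetric \<open>S\<close> cannot tell them apart.\<close>

lemma inner_cauchy_green_diff:
  assumes "S \<in> Sym"
  shows "S \<bullet> (cauchy_green F - cauchy_green F0)
           = 2 * ((F0 ** S) \<bullet> (F - F0)) + (S \<bullet> (transpose (F - F0) ** (F - F0)))"
  using inner_sym_transpose_mult[OF assms, of "F - F0" F0]
  by (simp only: cauchy_green_diff inner_add_right inner_transpose_mult)

text \<open>Row by row, \<open>S \<bullet> (H\<^sup>T H)\<close> is the sum of the values of the quadratic form of \<open>S\<close> at the rows of \<open>H\<close>.\<close>

lemma inner_transpose_mult_self_nonneg:
  assumes "S \<in> Sym_pos"
  shows "0 \<le> S \<bullet> (transpose H ** (H :: mat3))"
proof -
  have sym: "transpose S = S"
    using assms by (simp add: Sym_pos_def Sym_def)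
  have pos: "0 \<le> v \<bullet> (S *v v)" for v
    using assms by (cases "v = 0") (auto simp: Sym_pos_def less_imp_le)
  have "(H ** S) $ i = S *v (H $ i)" for i
  proof -
    have "S $ k $ j = S $ j $ k" for j k
      using arg_cong[OF sym, of "\<lambda>X. X $ j $ k"] by (simp add: transpose_def)
    then show ?thesis
      by (simp add: vec_eq_iff matrix_matrix_mult_def matrix_vector_mult_def mult.commute)
  qed
  then have "(H ** S) \<bullet> H = (\<Sum>i\<in>UNIV. (H $ i) \<bullet> (S *v (H $ i)))"
    by (subst inner_vec_def) (simp add: inner_commute[of "S *v _"])
  also have "\<dots> \<ge> 0"
    by (intro sum_nonneg pos)
  finally show ?thesis
    by (simp only: inner_transpose_mult)
qed

text \<open>The quadratic form of \<open>F\<^sup>T F\<close> at \<open>v\<close> is \<open>|F v|\<^sup>2\<close>, so definiteness means that \<open>F\<close> has trivial kernel. Thus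
  the gradients for which the energy density is meaningful form an open set, and differentiation in
  \<open>F\<close> is unrestricted there.\<close>

lemma cauchy_green_in_Sym_pos_iff: "cauchy_green F \<in> Sym_pos \<longleftrightarrow> det F \<noteq> 0"
proof -
  have sym: "cauchy_green F \<in> Sym"
    by (simp add: Sym_def cauchy_green_def matrix_transpose_mul)
  have "v \<bullet> (cauchy_green F *v v) = (norm (F *v v))\<^sup>2" for v
    using dot_lmul_matrix[of v "transpose F" "F *v v"]
    by (simp add: cauchy_green_def matrix_vector_mul_assoc[symmetric] vector_transpose_matrix
        power2_norm_eq_inner)
  then have "cauchy_green F \<in> Sym_pos \<longleftrightarrow> (\<forall>v. F *v v = 0 \<longrightarrow> v = 0)"
    using sym by (auto simp: Sym_pos_def)
  also have "\<dots> \<longleftrightarrow> det F \<noteq> 0"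
    by (metis matrix_left_invertible_ker invertible_det_nz invertible_left_inverse)
  finally show ?thesis .
qed

lemma open_det_nonzero: "open {F :: mat3. det F \<noteq> 0}"
proof -
  have "continuous_on UNIV (det :: mat3 \<Rightarrow> real)"
    unfolding det_def by (intro continuous_intros)
  then show ?thesis
    by (intro open_Collect_neq) auto
qed

lemma has_derivative_cauchy_green:
  "(cauchy_green has_derivative (\<lambda>H. transpose H ** F0 + transpose F0 ** H)) (at F0 within A)"
proof -
  have "linear (transpose :: mat3 \<Rightarrow> mat3)"
    by (auto intro!: linearI simp: transpose_def vec_eq_iff)
  then have "(transpose has_derivative transpose) (at F0 within A)"
    by (simp add: linear_conv_bounded_linear bounded_linear_imp_has_derivative)
  from bounded_bilinear.FDERIV[OF bounded_bilinear_matrix_mult this has_derivative_ident] show ?thesis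
    by (simp add: cauchy_green_def[abs_def] add.commute)
qed

section \<open>The tangent inequality for the energy density\<close>

text \<open>Differentiability relative to \<open>A\<close> suffices, since only the segment from \<open>x\<close> to \<open>y\<close> matters: the
  difference quotients along it are at most \<open>f y - f x\<close> and tend to \<open>f' (y - x)\<close>. This generality is
  needed because the positive definite symmetric matrices have empty interior among all matrices.\<close>

lemma convex_on_above_tangent_within:
  fixes f :: "'a::real_normed_vector \<Rightarrow> real"
  assumes convex: "convex_on A f" and "x \<in> A" "y \<in> A"
    and deriv: "(f has_derivative f') (at x within A)"
  shows "f' (y - x) \<le> f y - f x"
proof -
  define l where "l t = x + t *\<^sub>R (y - x)" for t :: real
  have l: "l t = (1 - t) *\<^sub>R x + t *\<^sub>R y" for t
    by (simp add: l_def algebra_simps)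
  have lA: "l ` {0..1} \<subseteq> A"
    using convex_on_imp_convex[OF convex] assms(2,3) by (auto simp: l convex_alt)
  have "(l has_derivative (\<lambda>h. h *\<^sub>R (y - x))) (at 0 within {0..1})"
    unfolding l_def by (auto intro!: derivative_eq_intros)
  moreover have "(f has_derivative f') (at (l 0) within l ` {0..1})"
    using has_derivative_subset[OF deriv lA] by (simp add: l_def)
  ultimately have "((\<lambda>t. f (l t)) has_derivative (\<lambda>h. f' (h *\<^sub>R (y - x)))) (at 0 within {0..1})"
    by (rule has_derivative_in_compose)
  moreover have "f' (h *\<^sub>R (y - x)) = f' (y - x) * h" for h
    using has_derivative_bounded_linear[OF deriv] by (simp add: linear_simps)
  ultimately have "((\<lambda>t. f (l t)) has_field_derivative f' (y - x)) (at 0 within {0..1})"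
    by (simp add: has_field_derivative_def)
  then have lim: "((\<lambda>t. (f (l t) - f x) / t) \<longlongrightarrow> f' (y - x)) (at 0 within {0..1})"
    by (simp add: has_field_derivative_iff l_def)
  have "(f (l t) - f x) / t \<le> f y - f x" if "t \<in> {0..1}" "t \<noteq> 0" for t
  proof -
    have "f (l t) \<le> (1 - t) * f x + t * f y"
      using convex_onD[OF convex, of t x y] that assms(2,3) by (simp add: l)
    with that show ?thesis by (simp add: divide_simps) (simp add: algebra_simps)
  qed
  then have "eventually (\<lambda>t. (f (l t) - f x) / t \<le> f y - f x) (at 0 within {0..1})"
    by (auto simp: eventually_at_filter)
  moreover have "at (0::real) within {0..1} \<noteq> bot"
    by (simp add: trivial_limit_within islimpt_Icc)
  ultimately show ?thesis
    using tendsto_upperbound[OF lim] by blast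
qed

text \<open>Increments within the symmetric matrices see only the symmetric part of a matrix representing the
  derivative, so a symmetric representative exists and the choice operator picks one.\<close>

lemma D_C_works:
  assumes "What differentiable_on Sym_pos" "C \<in> Sym_pos"
  shows "D_C What C \<in> Sym"
    and "(What has_derivative (\<lambda>H. D_C What C \<bullet> H)) (at C within Sym_pos)"
proof -
  obtain D where D: "(What has_derivative D) (at C within Sym_pos)"
    using assms by (auto simp: differentiable_on_def differentiable_def)
  then have blin: "bounded_linear D"
    by (rule has_derivative_bounded_linear)
  \<comment> \<open>the matrix representing \<open>D\<close> through the inner product\<close>
  define A where "A = adjoint D 1"
  have A: "D H = A \<bullet> H" for H
    using adjoint_works[OF bounded_linear.linear[OF blin], of H 1]
    by (simp add: A_def inner_commute)
  define S where "S = (1/2) *\<^sub>R (A + transpose A)"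
  have "S \<in> Sym"
    by (simp add: S_def Sym_def transpose_def vec_eq_iff add.commute)
  have S: "S \<bullet> H = D H" if "H \<in> Sym" for H
    using that matrix_inner_transpose[of A H] by (simp add: S_def A Sym_def inner_add_left)
  have "(What has_derivative (\<lambda>H. S \<bullet> H)) (at C within Sym_pos)"
    using D unfolding has_derivative_within
  proof (elim conjE, intro conjI)
    assume "((\<lambda>y. (1 / norm (y - C)) *\<^sub>R (What y - (What C + D (y - C)))) \<longlongrightarrow> 0) (at C within Sym_pos)"
    moreover have "S \<bullet> (y - C) = D (y - C)" if "y \<in> Sym_pos" for y
      using that assms(2) by (intro S) (auto simp: Sym_pos_def Sym_def transpose_def vec_eq_iff)
    ultimately show "((\<lambda>y. (1 / norm (y - C)) *\<^sub>R (What y - (What C + S \<bullet> (y - C)))) \<longlongrightarrow> 0) (at C within Sym_pos)"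
      by (elim Lim_transform_eventually) (auto simp: eventually_at_filter)
  qed (rule bounded_linear_inner_right)
  with \<open>S \<in> Sym\<close> have "\<exists>S. S \<in> Sym \<and> (What has_derivative (\<lambda>H. S \<bullet> H)) (at C within Sym_pos)"
    by blast
  from someI_ex[OF this] show "D_C What C \<in> Sym"
    "(What has_derivative (\<lambda>H. D_C What C \<bullet> H)) (at C within Sym_pos)"
    by (simp_all add: D_C_def)
qed

text \<open>Chain rule: near an invertible \<open>F0\<close> the Cauchy-Green tensor stays in the set within which \<open>What\<close> is
  differentiated.\<close>

lemma W_of_has_derivative:
  assumes "What differentiable_on Sym_pos" "det F0 \<noteq> 0"
  shows "(W_of What has_derivative (\<lambda>H. (2 *\<^sub>R (F0 ** D_C What (cauchy_green F0))) \<bullet> H)) (at F0)"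
proof -
  let ?U = "{F :: mat3. det F \<noteq> 0}" and ?S = "D_C What (cauchy_green F0)"
  have C0: "cauchy_green F0 \<in> Sym_pos"
    using assms by (simp add: cauchy_green_in_Sym_pos_iff)
  have "(What has_derivative (\<lambda>H. ?S \<bullet> H)) (at (cauchy_green F0) within cauchy_green ` ?U)"
    by (rule has_derivative_subset[OF D_C_works(2)[OF assms(1) C0]])
      (auto simp: cauchy_green_in_Sym_pos_iff)
  from has_derivative_in_compose[OF has_derivative_cauchy_green this]
  have "(W_of What has_derivative (\<lambda>H. ?S \<bullet> (transpose H ** F0 + transpose F0 ** H))) (at F0 within ?U)"
    by (simp add: W_of_def[abs_def])
  also have "(\<lambda>H. ?S \<bullet> (transpose H ** F0 + transpose F0 ** H)) = (\<lambda>H. (2 *\<^sub>R (F0 ** ?S)) \<bullet> H)"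
    using inner_sym_transpose_mult[OF D_C_works(1)[OF assms(1) C0], of _ F0]
    by (simp add: inner_add_right inner_transpose_mult)
  finally show ?thesis
    using at_within_open[OF _ open_det_nonzero, of F0] assms(2) by simp
qed

lemma piola1_eq:
  assumes "What differentiable_on Sym_pos" "det F \<noteq> 0"
  shows "piola1 What F = F ** piola2 What (cauchy_green F)"
proof -
  note W = W_of_has_derivative[OF assms]
  have "(W_of What has_derivative (\<lambda>H. piola1 What F \<bullet> H)) (at F)"
    unfolding piola1_def D_F_def by (rule someI, rule W)
  from has_derivative_unique[OF this W]
  have "piola1 What F \<bullet> H = (2 *\<^sub>R (F ** D_C What (cauchy_green F))) \<bullet> H" for H
    by metis
  then show ?thesis
    by (subst vector_eq_rdot[symmetric]) (simp add: piola2_def inner_transpose_mult[symmetric])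
qed

text \<open>The tangent of \<open>What\<close> at \<open>C\<^sub>0\<close>, taken at \<open>C\<close>, exceeds the tangent of \<open>W\<close> at \<open>F\<^sub>0\<close>, taken at \<open>F\<close>, by the
  quadratic term; its sign is where definiteness of the stress enters.\<close>

lemma W_of_above_tangent:
  assumes diff: "What differentiable_on Sym_pos" and convex: "convex_on Sym_pos What"
    and F: "det F \<noteq> 0" and F0: "det F0 \<noteq> 0"
    and S2: "piola2 What (cauchy_green F0) \<in> Sym_pos"
  shows "W_of What F0 + piola1 What F0 \<bullet> (F - F0) \<le> W_of What F"
proof -
  let ?S = "D_C What (cauchy_green F0)"
  have C: "cauchy_green F \<in> Sym_pos" and C0: "cauchy_green F0 \<in> Sym_pos"
    using F F0 by (simp_all add: cauchy_green_in_Sym_pos_iff)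
  note S = D_C_works[OF diff C0]
  have "piola1 What F0 \<bullet> (F - F0) = 2 * ((F0 ** ?S) \<bullet> (F - F0))"
    by (simp add: piola1_eq[OF diff F0] piola2_def inner_transpose_mult[symmetric])
  also have "\<dots> \<le> 2 * ((F0 ** ?S) \<bullet> (F - F0)) + ?S \<bullet> (transpose (F - F0) ** (F - F0))"
    using inner_transpose_mult_self_nonneg[OF S2, of "F - F0"] by (simp add: piola2_def)
  also have "\<dots> = ?S \<bullet> (cauchy_green F - cauchy_green F0)"
    by (rule inner_cauchy_green_diff[OF S(1), symmetric])
  also have "\<dots> \<le> What (cauchy_green F) - What (cauchy_green F0)"
    by (rule convex_on_above_tangent_within[OF convex C0 C S(2)])
  finally show ?thesis
    by (simp add: W_of_def)
qed

section \<open>Positivity sets of functions of class C1\<close>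

text \<open>The indicator function of such a set, if it is relatively compact in the domain, is a limit of test
  functions. Every open set has this form, but a class closed under intersection that generates the
  Borel sets is enough, and is easier to exhibit.\<close>

definition C1_positivity_set :: "'a::euclidean_space set \<Rightarrow> bool" where
  "C1_positivity_set U \<longleftrightarrow>
     (\<exists>g Dg. (\<forall>x. (g has_derivative (\<lambda>h. Dg x \<bullet> h)) (at x)) \<and> continuous_on UNIV Dg \<and>
        (\<forall>x. 0 \<le> g x) \<and> U = {x. (0::real) < g x})"

lemma C1_positivity_setI:
  assumes "\<And>x. (g has_derivative D x) (at x)" "\<And>x h. D x h = Dg x \<bullet> h" "continuous_on UNIV Dg"
    "\<And>x. (0::real) \<le> g x" "U = {x. 0 < g x}"
  shows "C1_positivity_set U"
proof -
  have "D x = (\<lambda>h. Dg x \<bullet> h)" for x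
    using assms(2) by blast
  then show ?thesis
    unfolding C1_positivity_set_def using assms by (intro exI[of _ g] exI[of _ Dg]) auto
qed

lemma C1_positivity_set_UNIV: "C1_positivity_set (UNIV :: 'a::euclidean_space set)"
  by (rule C1_positivity_setI[of "\<lambda>_. 1" _ "\<lambda>_. 0"]) (auto intro: has_derivative_const)

lemma C1_positivity_set_Int:
  assumes "C1_positivity_set U" "C1_positivity_set V"
  shows "C1_positivity_set (U \<inter> V)"
proof -
  obtain f Df where f: "\<And>x. (f has_derivative (\<lambda>h. Df x \<bullet> h)) (at x)" "continuous_on UNIV Df"
      "\<And>x. 0 \<le> f x" "U = {x. (0::real) < f x}"
    using assms(1) unfolding C1_positivity_set_def by blast
  obtain g Dg where g: "\<And>x. (g has_derivative (\<lambda>h. Dg x \<bullet> h)) (at x)" "continuous_on UNIV Dg"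
      "\<And>x. 0 \<le> g x" "V = {x. (0::real) < g x}"
    using assms(2) unfolding C1_positivity_set_def by blast
  have "((\<lambda>x. f x * g x) has_derivative (\<lambda>h. (f x *\<^sub>R Dg x + g x *\<^sub>R Df x) \<bullet> h)) (at x)" for x
    by (rule has_derivative_eq_rhs[OF has_derivative_mult[OF f(1) g(1)]])
      (simp add: inner_add_left mult.commute)
  moreover have "continuous_on UNIV f" "continuous_on UNIV g"
    using has_derivative_continuous_on[OF f(1)] has_derivative_continuous_on[OF g(1)] by auto
  then have "continuous_on UNIV (\<lambda>x. f x *\<^sub>R Dg x + g x *\<^sub>R Df x)"
    by (intro continuous_intros f(2) g(2))
  moreover have "U \<inter> V = {x. 0 < f x * g x}"
  proof (rule set_eqI)
    fix x show "x \<in> U \<inter> V \<longleftrightarrow> x \<in> {x. 0 < f x * g x}"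
      using f(3)[of x] g(3)[of x] by (auto simp: f(4) g(4) zero_less_mult_iff)
  qed
  ultimately show ?thesis
    unfolding C1_positivity_set_def using f(3) g(3)
    by (intro exI[of _ "\<lambda>x. f x * g x"] exI[of _ "\<lambda>x. f x *\<^sub>R Dg x + g x *\<^sub>R Df x"]) auto
qed

lemma has_real_derivative_max_0_square:
  "((\<lambda>t::real. (max 0 t)\<^sup>2) has_real_derivative 2 * max 0 t) (at t)"
proof (cases t "0 :: real" rule: linorder_cases)
  case less
  have "((\<lambda>t::real. 0) has_real_derivative 2 * max 0 t) (at t)"
    using less by (simp add: max_def)
  then show ?thesis
    by (rule has_field_derivative_transform_within_open[of _ _ _ "{..<0}"]) (use less in auto)
next
  case greater
  have "((\<lambda>t::real. t\<^sup>2) has_real_derivative 2 * max 0 t) (at t)"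
    using greater by (auto intro!: derivative_eq_intros)
  then show ?thesis
    by (rule has_field_derivative_transform_within_open[of _ _ _ "{0<..}"]) (use greater in auto)
next
  case equal
  have "((\<lambda>h::real. (max 0 h)\<^sup>2 / h) \<longlongrightarrow> 0) (at 0)"
  proof (rule Lim_null_comparison)
    show "\<forall>\<^sub>F h in at 0. norm ((max 0 h)\<^sup>2 / h) \<le> \<bar>h\<bar>"
      by (auto simp: max_def power2_eq_square)
    show "((\<lambda>h::real. \<bar>h\<bar>) \<longlongrightarrow> 0) (at 0)"
      by (intro tendsto_eq_intros) auto
  qed
  then show ?thesis
    using equal by (simp add: DERIV_def)
qed

text \<open>The function \<open>(max 0 (r\<^sup>2 - |x - c|\<^sup>2))\<^sup>2\<close> is a witness; squaring the positive part smooths the kink at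
  the boundary of the ball.\<close>

lemma C1_positivity_set_ball: "C1_positivity_set (ball (c :: 'a::euclidean_space) r)"
proof (cases "r \<le> 0")
  case True
  then show ?thesis
    by (intro C1_positivity_setI[of "\<lambda>_. 0" _ "\<lambda>_. 0"]) (auto simp: ball_empty intro: has_derivative_const)
next
  case False
  define s where "s x = r\<^sup>2 - (x - c) \<bullet> (x - c)" for x
  define Dg where "Dg x = - (4 * max 0 (s x)) *\<^sub>R (x - c)" for x
  have "(s has_derivative (\<lambda>h. - 2 * ((x - c) \<bullet> h))) (at x)" for x
    unfolding s_def by (auto intro!: derivative_eq_intros simp: inner_commute)
  from has_derivative_compose[OF this has_real_derivative_max_0_square[unfolded has_field_derivative_def]]
  have "((\<lambda>x. (max 0 (s x))\<^sup>2) has_derivative (\<lambda>h. Dg x \<bullet> h)) (at x)" for x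
    by (rule has_derivative_eq_rhs) (auto simp: Dg_def)
  moreover have "continuous_on UNIV Dg"
    unfolding Dg_def s_def by (intro continuous_intros)
  moreover have "ball c r = {x. 0 < (max 0 (s x))\<^sup>2}"
  proof -
    have "x \<in> ball c r \<longleftrightarrow> (norm (x - c))\<^sup>2 < r\<^sup>2" for x
      using False power_mono_iff[of r "norm (x - c)" 2]
      unfolding mem_ball dist_norm norm_minus_commute[of c x] not_le[symmetric] by simp
    then show ?thesis
      by (auto simp: s_def power2_norm_eq_inner max_def)
  qed
  ultimately show ?thesis
    unfolding C1_positivity_set_def
    by (intro exI[of _ "\<lambda>x. (max 0 (s x))\<^sup>2"] exI[of _ Dg]) auto
qed

lemma C1_positivity_set_open:
  assumes "C1_positivity_set U"
  shows "open U"
proof -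
  obtain g Dg where g: "\<And>x. (g has_derivative (\<lambda>h. Dg x \<bullet> h)) (at x)" "U = {x. (0::real) < g x}"
    using assms unfolding C1_positivity_set_def by blast
  have "continuous_on UNIV g"
    using has_derivative_continuous_on[OF g(1)] .
  then show ?thesis
    unfolding g(2) by (intro open_Collect_less continuous_on_const)
qed

text \<open>Balls are positivity sets, and every open set is a countable union of balls.\<close>

lemma borel_eq_C1_positivity_sets:
  "sets borel = sigma_sets UNIV (Collect (C1_positivity_set :: 'a::euclidean_space set \<Rightarrow> bool))"
proof (intro equalityI subsetI)
  fix A :: "'a set"
  have "U \<in> sigma_sets UNIV (Collect C1_positivity_set)" if "open U" for U :: "'a set"
  proof -
    let ?F = "{ball x r | x r. ball x r \<subseteq> U}"
    obtain F where F: "F \<subseteq> ?F" "countable F" "\<Union>F = \<Union>?F"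
    proof (rule Lindelof[of ?F])
      show "open S" if "S \<in> ?F" for S
        using that by auto
    qed
    have "B \<in> sigma_sets UNIV (Collect C1_positivity_set)" if "B \<in> F" for B
    proof -
      have "B \<in> ?F"
        using F(1) \<open>B \<in> F\<close> by (rule subsetD)
      then obtain x r where B: "B = ball x r"
        by (elim CollectE exE conjE)
      show ?thesis
        unfolding B by (intro sigma_sets.Basic CollectI C1_positivity_set_ball)
    qed
    with F(2) have "\<Union>F \<in> sigma_sets UNIV (Collect C1_positivity_set)"
      by (rule sigma_sets_UNION)
    moreover have "\<Union>?F = U"
    proof
      show "\<Union>?F \<subseteq> U"
        by (intro Union_least) (elim CollectE exE conjE, simp)
      show "U \<subseteq> \<Union>?F"
      proof
        fix x assume "x \<in> U"
        with that obtain e where "0 < e" "ball x e \<subseteq> U"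
          by (meson openE)
        then have "ball x e \<in> ?F"
          by (intro CollectI exI[of _ x] exI[of _ e] conjI refl)
        then show "x \<in> \<Union>?F"
          by (rule UnionI) (simp add: \<open>0 < e\<close>)
      qed
    qed
    ultimately show ?thesis
      by (simp only: F(3))
  qed
  then have "sigma_sets UNIV {S. open S} \<subseteq> sigma_sets UNIV (Collect (C1_positivity_set :: 'a set \<Rightarrow> bool))"
    by (intro sigma_sets_mono subsetI) simp
  moreover assume "A \<in> sets borel"
  then have "A \<in> sigma_sets UNIV {S. open S}"
    by (simp add: borel_def)
  ultimately show "A \<in> sigma_sets UNIV (Collect C1_positivity_set)"
    by (rule subsetD)
next
  fix A :: "'a set" assume "A \<in> sigma_sets UNIV (Collect C1_positivity_set)"
  then show "A \<in> sets borel"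
    using sets.sigma_sets_subset[of "Collect C1_positivity_set" "borel :: 'a measure"]
      C1_positivity_set_open by (metis borel_open mem_Collect_eq space_borel subsetD subsetI)
qed

text \<open>The functions \<open>n g / (1 + n g)\<close> lie between 0 and 1, vanish exactly where \<open>g\<close> does, and tend to 1
  wherever \<open>g\<close> is positive. The compact set \<open>K\<close> provides the compact support inside \<open>\<Omega>\<close>.\<close>

lemma indicator_cutoff_sequence:
  fixes U :: "vec3 set"
  assumes "C1_positivity_set U" "compact K" "U \<subseteq> K" "K \<subseteq> \<Omega>"
  obtains \<psi> D\<psi> where "\<And>n. test_function \<Omega> (\<psi> n) (D\<psi> n)"
    "\<And>n x. norm (\<psi> n x) \<le> 1" "\<And>x. (\<lambda>n. \<psi> n x) \<longlonglongrightarrow> indicator U x" "\<And>n x. x \<notin> U \<Longrightarrow> \<psi> n x = 0"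
proof -
  obtain g Dg where g: "\<And>x. (g has_derivative (\<lambda>h. Dg x \<bullet> h)) (at x)" "continuous_on UNIV Dg"
      "\<And>x. 0 \<le> g x" "U = {x. (0::real) < g x}"
    using assms(1) unfolding C1_positivity_set_def by blast
  define \<psi> where "\<psi> n x = real n * g x / (1 + real n * g x)" for n x
  define D\<psi> where "D\<psi> n x = (real n / (1 + real n * g x)\<^sup>2) *\<^sub>R Dg x" for n x
  have pos: "0 < 1 + real n * g x" for n x
    using g(3)[of x] by (simp add: add_pos_nonneg)
  have zero: "\<psi> n x = 0" if "x \<notin> U" for n x
    using that g(3)[of x] by (simp add: \<psi>_def g(4))
  have cg: "continuous_on UNIV g"
    using has_derivative_continuous_on[OF g(1)] .
  have "test_function \<Omega> (\<psi> n) (D\<psi> n)" for n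
    unfolding test_function_def
  proof (intro conjI allI)
    fix x
    have "((\<lambda>t. real n * t / (1 + real n * t)) has_real_derivative real n / (1 + real n * g x)\<^sup>2) (at (g x))"
      using pos[of n x] by (auto intro!: derivative_eq_intros simp: power2_eq_square field_simps)
    from has_derivative_compose[OF g(1) this[unfolded has_field_derivative_def]]
    show "(\<psi> n has_derivative (\<lambda>h. D\<psi> n x \<bullet> h)) (at x)"
      unfolding \<psi>_def D\<psi>_def by (rule has_derivative_eq_rhs) (simp add: fun_eq_iff)
  next
    show "continuous_on UNIV (D\<psi> n)"
      unfolding D\<psi>_def using pos by (intro continuous_intros g(2) cg) (auto simp: less_imp_neq[symmetric])
  next
    have "closure {x. \<psi> n x \<noteq> 0} \<subseteq> K"
      using zero assms(2,3) by (intro closure_minimal compact_imp_closed) auto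
    then show "closure {x. \<psi> n x \<noteq> 0} \<subseteq> \<Omega>"
      using assms(4) by (rule subset_trans)
    show "compact (closure {x. \<psi> n x \<noteq> 0})"
      using \<open>closure {x. \<psi> n x \<noteq> 0} \<subseteq> K\<close> assms(2)
      by (meson bounded_subset closed_closure compact_eq_bounded_closed)
  qed
  moreover have "norm (\<psi> n x) \<le> 1" for n x
    using pos[of n x] g(3)[of x] by (simp add: \<psi>_def divide_simps)
  moreover have "(\<lambda>n. \<psi> n x) \<longlonglongrightarrow> indicator U x" for x
  proof (cases "x \<in> U")
    case True
    then have "0 < g x" by (simp add: g(4))
    then have "(\<lambda>n. 1 - 1 / (1 + real n * g x)) \<longlonglongrightarrow> 1"
      by real_asymp
    moreover have "\<psi> n x = 1 - 1 / (1 + real n * g x)" for n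
      using pos[of n x] by (simp add: \<psi>_def field_simps)
    ultimately show ?thesis
      using True by simp
  qed (simp add: zero)
  ultimately show ?thesis
    using zero that by blast
qed

section \<open>The fundamental lemma of the calculus of variations\<close>

lemma borel_measurable_lebesgue_if_continuous:
  "continuous_on UNIV (f :: 'a::euclidean_space \<Rightarrow> 'b::real_normed_vector) \<Longrightarrow> f \<in> borel_measurable lebesgue"
  by (simp add: borel_measurable_continuous_onI measurable_completion)

text \<open>Dominated convergence along the cutoff functions of \<open>U\<close>, with majorant \<open>|f|\<close> on \<open>K\<close>.\<close>

lemma integral_eq_0_on_C1_positivity_set:
  fixes f :: "vec3 \<Rightarrow> real"
  assumes int: "set_integrable lebesgue K f"
    and zero: "\<And>\<psi> D\<psi>. test_function \<Omega> \<psi> D\<psi> \<Longrightarrow> (LINT x:\<Omega>|lebesgue. f x * \<psi> x) = 0"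
    and U: "C1_positivity_set U" and K: "compact K" "U \<subseteq> K" "K \<subseteq> \<Omega>"
  shows "(LINT x:U|lebesgue. f x) = 0"
proof -
  obtain \<psi> D\<psi> where \<psi>: "\<And>n. test_function \<Omega> (\<psi> n) (D\<psi> n)" "\<And>n x. norm (\<psi> n x) \<le> 1"
    "\<And>x. (\<lambda>n. \<psi> n x) \<longlonglongrightarrow> indicator U x" "\<And>n x. x \<notin> U \<Longrightarrow> \<psi> n x = 0"
    using indicator_cutoff_sequence[OF U K] by blast
  define k where "k x = indicator K x *\<^sub>R f x" for x
  have k: "integrable lebesgue k"
    using int by (simp add: set_integrable_def k_def[abs_def])
  have [measurable]: "U \<in> sets lebesgue"
    using C1_positivity_set_open[OF U] by simp
  have [measurable]: "k \<in> borel_measurable lebesgue"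
    using k by (rule borel_measurable_integrable)
  have [measurable]: "\<psi> n \<in> borel_measurable lebesgue" for n
    using \<psi>(1)[of n] has_derivative_continuous_on[of UNIV "\<psi> n" "\<lambda>x h. D\<psi> n x \<bullet> h"]
    by (intro borel_measurable_lebesgue_if_continuous) (auto simp: test_function_def)
  have "(\<lambda>n. LINT x|lebesgue. k x * \<psi> n x) \<longlonglongrightarrow> (LINT x|lebesgue. k x * indicator U x)"
  proof (rule integral_dominated_convergence)
    show "integrable lebesgue (\<lambda>x. norm (k x))"
      using k by (rule integrable_norm)
    show "AE x in lebesgue. (\<lambda>n. k x * \<psi> n x) \<longlonglongrightarrow> k x * indicator U x"
      by (intro AE_I2 tendsto_mult tendsto_const \<psi>(3))
    show "AE x in lebesgue. norm (k x * \<psi> n x) \<le> norm (k x)" for n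
      using \<psi>(2)[of n] by (intro AE_I2) (simp add: abs_mult mult_left_le)
    show "(\<lambda>x. k x * indicator U x) \<in> borel_measurable lebesgue"
      by measurable
  qed measurable
  moreover have "(LINT x|lebesgue. k x * \<psi> n x) = 0" for n
  proof -
    have "(\<lambda>x. k x * \<psi> n x) = (\<lambda>x. indicator \<Omega> x *\<^sub>R (f x * \<psi> n x))"
      using \<psi>(4)[of _ n] K(2,3) by (fastforce simp: indicator_def k_def)
    then show ?thesis
      using zero[OF \<psi>(1)[of n]] by (simp add: set_lebesgue_integral_def)
  qed
  moreover have "(\<lambda>x. k x * indicator U x) = (\<lambda>x. indicator U x *\<^sub>R f x)"
    using K(2) by (auto simp: k_def fun_eq_iff split: split_indicator)
  ultimately show ?thesis
    by (simp add: set_lebesgue_integral_def LIMSEQ_const_iff)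
qed

text \<open>Dynkin argument: the sets over which \<open>h\<close> integrates to zero are closed under complements and
  countable disjoint unions, and they contain an intersection-stable generator of the Borel sets.\<close>

lemma integral_eq_0_on_borel_sets:
  fixes h :: "'a::euclidean_space \<Rightarrow> real"
  assumes h: "integrable lebesgue h"
    and zero: "\<And>U. C1_positivity_set U \<Longrightarrow> (LINT x:U|lebesgue. h x) = 0"
    and A: "A \<in> sets borel"
  shows "(LINT x:A|lebesgue. h x) = 0"
proof -
  have hA: "integrable lebesgue (\<lambda>x. indicator A x *\<^sub>R h x)" if "A \<in> sets borel" for A
    using that by (intro integrable_mult_indicator h) simp
  have "Int_stable (Collect (C1_positivity_set :: 'a set \<Rightarrow> bool))"
    by (intro Int_stableI) (simp add: C1_positivity_set_Int)
  moreover have "Collect C1_positivity_set \<subseteq> Pow (UNIV :: 'a set)"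
    by simp
  moreover have "A \<in> sigma_sets UNIV (Collect C1_positivity_set)"
    using A by (simp add: borel_eq_C1_positivity_sets)
  ultimately show ?thesis
  proof (induction rule: sigma_sets_induct_disjoint)
    case (basic A)
    then show ?case using zero by simp
  next
    case empty
    then show ?case by (simp add: set_lebesgue_integral_def)
  next
    case (compl A)
    then have [measurable]: "A \<in> sets borel"
      by (simp add: borel_eq_C1_positivity_sets)
    have "(\<lambda>x. indicator (UNIV - A) x *\<^sub>R h x) = (\<lambda>x. h x - indicator A x *\<^sub>R h x)"
      by (auto simp: indicator_def)
    moreover have "integral\<^sup>L lebesgue h = 0"
      using zero[OF C1_positivity_set_UNIV] by (simp add: set_lebesgue_integral_def)
    ultimately show ?case
      using compl(2) hA[of A] h by (simp add: set_lebesgue_integral_def)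
  next
    case (union A)
    then have A: "A i \<in> sets borel" for i
      by (auto simp: borel_eq_C1_positivity_sets)
    have "(LINT x:(\<Union>i. A i)|lebesgue. h x) = (\<Sum>i. LINT x:A i|lebesgue. h x)"
      using A union(1) hA[of "\<Union>i. A i"]
      by (intro lebesgue_integral_countable_add) (auto simp: set_integrable_def disjoint_family_on_def)
    then show ?case
      using union(3) by simp
  qed
qed

text \<open>A Lebesgue set differs from a Borel set by a null set, so the integrals of \<open>h\<close> over \<open>{h > 0}\<close> and
  \<open>{h < 0}\<close> vanish.\<close>

lemma AE_eq_0_if_integral_on_borel_sets_eq_0:
  fixes h :: "'a::euclidean_space \<Rightarrow> real"
  assumes h: "integrable lebesgue h"
    and zero: "\<And>A. A \<in> sets borel \<Longrightarrow> (LINT x:A|lebesgue. h x) = 0"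
  shows "AE x in lebesgue. h x = 0"
proof -
  have [measurable]: "h \<in> borel_measurable lebesgue"
    using h by (rule borel_measurable_integrable)
  have zero': "(LINT x|lebesgue. indicator A x * h x) = 0" if leb: "A \<in> sets lebesgue" for A
  proof -
    obtain S N N' where A: "A = S \<union> N" "N \<subseteq> N'" "N' \<in> null_sets lborel" "S \<in> sets lborel"
      using leb by (rule sets_completionE)
    have [measurable]: "A \<in> sets lebesgue" "S \<in> sets lebesgue"
      using leb A(4) by auto
    have "AE x in lebesgue. x \<notin> N'"
      by (intro AE_not_in null_sets_completionI A(3))
    then have "AE x in lebesgue. indicator A x * h x = indicator S x *\<^sub>R h x"
      by eventually_elim (use A(1,2) in \<open>auto simp: indicator_def\<close>)
    then have "(LINT x|lebesgue. indicator A x * h x) = (LINT x|lebesgue. indicator S x *\<^sub>R h x)"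
      by (intro integral_cong_AE) measurable
    also have "\<dots> = 0"
      using zero[of S] A(4) by (simp add: set_lebesgue_integral_def)
    finally show ?thesis .
  qed
  have int: "integrable lebesgue (\<lambda>x. indicator A x * h x)" if "A \<in> sets lebesgue" for A
    using integrable_mult_indicator[OF that h] by simp
  have "{x \<in> space lebesgue. 0 < h x} \<in> sets lebesgue" "{x \<in> space lebesgue. h x < 0} \<in> sets lebesgue"
    by measurable
  then have P: "{x. 0 < h x} \<in> sets lebesgue" and N: "{x. h x < 0} \<in> sets lebesgue"
    by simp_all
  have "AE x in lebesgue. indicator {x. 0 < h x} x * h x = 0"
    using zero'[OF P] by (subst (asm) integral_nonneg_eq_0_iff_AE[OF int[OF P]]) (auto simp: indicator_def)
  moreover have "AE x in lebesgue. - (indicator {x. h x < 0} x * h x) = 0"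
    using zero'[OF N] int[OF N]
    by (subst integral_nonneg_eq_0_iff_AE[symmetric]) (auto simp: indicator_def)
  ultimately show ?thesis
    by eventually_elim (auto simp: indicator_def split: if_splits)
qed

text \<open>Integrability is only local, so the preceding lemmas are applied to \<open>f\<close> cut off to balls whose
  closure lies in \<open>\<Omega>\<close>. The intersection of a positivity set with such a ball is again a positivity set,
  now with compact closure in \<open>\<Omega>\<close>; countably many of these balls cover \<open>\<Omega>\<close>.\<close>

lemma fundamental_lemma_calculus_of_variations:
  fixes f :: "vec3 \<Rightarrow> real"
  assumes \<Omega>: "open \<Omega>"
    and int: "\<And>K. compact K \<Longrightarrow> K \<subseteq> \<Omega> \<Longrightarrow> set_integrable lebesgue K f"
    and zero: "\<And>\<psi> D\<psi>. test_function \<Omega> \<psi> D\<psi> \<Longrightarrow> (LINT x:\<Omega>|lebesgue. f x * \<psi> x) = 0"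
  shows "AE x in lebesgue. x \<in> \<Omega> \<longrightarrow> f x = 0"
proof -
  have ball: "AE x in lebesgue. x \<in> ball c r \<longrightarrow> f x = 0" if cball: "cball c r \<subseteq> \<Omega>" for c r
  proof -
    let ?h = "\<lambda>x. indicator (ball c r) x *\<^sub>R f x"
    have h: "integrable lebesgue ?h"
      using set_integrable_subset[OF int[OF compact_cball cball], of "ball c r"] ball_subset_cball
      by (simp add: set_integrable_def)
    have zero_h: "(LINT x:U|lebesgue. ?h x) = 0" if "C1_positivity_set U" for U
    proof -
      have "(LINT x:U \<inter> ball c r|lebesgue. f x) = 0"
      proof (rule integral_eq_0_on_C1_positivity_set[OF int[OF compact_cball cball] zero])
        show "C1_positivity_set (U \<inter> ball c r)"
          by (intro C1_positivity_set_Int that C1_positivity_set_ball)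
        show "U \<inter> ball c r \<subseteq> cball c r"
          using ball_subset_cball by (rule le_infI2)
      qed (use cball in simp_all)
      moreover have "(\<lambda>x. indicator (U \<inter> ball c r) x *\<^sub>R f x) = (\<lambda>x. indicator U x *\<^sub>R ?h x)"
        by (auto simp: fun_eq_iff split: split_indicator)
      ultimately show ?thesis
        by (simp only: set_lebesgue_integral_def)
    qed
    have "AE x in lebesgue. ?h x = 0"
      by (rule AE_eq_0_if_integral_on_borel_sets_eq_0[OF h])
        (rule integral_eq_0_on_borel_sets[OF h zero_h])
    then show ?thesis
      by eventually_elim (auto simp: indicator_def)
  qed
  define B where "B = {(c, r). cball c r \<subseteq> \<Omega>}"
  obtain F where F: "F \<subseteq> (\<lambda>(c, r). ball c r) ` B" "countable F" "\<Union>F = \<Union>((\<lambda>(c, r). ball c r) ` B)"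
  proof (rule Lindelof[of "(\<lambda>(c, r). ball c r) ` B"])
    show "open S" if "S \<in> (\<lambda>(c, r). ball c r) ` B" for S
      using that by auto
  qed
  have "AE x in lebesgue. \<forall>S\<in>F. x \<in> S \<longrightarrow> f x = 0"
  proof (rule AE_ball_countable')
    show "AE x in lebesgue. x \<in> S \<longrightarrow> f x = 0" if "S \<in> F" for S
    proof -
      obtain c r where "S = ball c r" "cball c r \<subseteq> \<Omega>"
        using subsetD[OF F(1) \<open>S \<in> F\<close>] by (auto simp: B_def)
      then show ?thesis
        using ball by simp
    qed
  qed (rule F(2))
  then show ?thesis
  proof eventually_elim
    case (elim x)
    show ?case
    proof
      assume "x \<in> \<Omega>"
      then obtain e where e: "0 < e" "cball x e \<subseteq> \<Omega>"
        using \<Omega> by (meson open_contains_cball)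
      then have "ball x e \<in> (\<lambda>(c, r). ball c r) ` B"
        by (intro image_eqI[of _ _ "(x, e)"]) (auto simp: B_def)
      then have "x \<in> \<Union>F"
        unfolding F(3) by (rule UnionI) (simp add: e(1))
      with elim show "f x = 0"
        by blast
    qed
  qed
qed

section \<open>Weak gradients are unique and additive\<close>

lemma set_integrable_mult_compact_support:
  fixes f \<psi> :: "vec3 \<Rightarrow> real"
  assumes f: "set_integrable lebesgue K f" and K: "compact K" "K \<subseteq> \<Omega>"
    and \<psi>: "continuous_on UNIV \<psi>" "\<And>x. x \<notin> K \<Longrightarrow> \<psi> x = 0"
  shows "set_integrable lebesgue \<Omega> (\<lambda>x. f x * \<psi> x)"
proof -
  define k where "k x = indicator K x *\<^sub>R f x" for x
  have k: "integrable lebesgue k"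
    using f by (simp add: set_integrable_def k_def[abs_def])
  have [measurable]: "k \<in> borel_measurable lebesgue" "\<psi> \<in> borel_measurable lebesgue"
    using k \<psi>(1) by (auto intro: borel_measurable_lebesgue_if_continuous)
  have "bounded (\<psi> ` K)"
    using compact_continuous_image[OF continuous_on_subset[OF \<psi>(1)] K(1)] compact_imp_bounded by simp
  then obtain B where B: "\<And>x. x \<in> K \<Longrightarrow> \<bar>\<psi> x\<bar> \<le> B"
    by (auto simp: bounded_iff)
  have "integrable lebesgue (\<lambda>x. k x * \<psi> x)"
  proof (rule Bochner_Integration.integrable_bound)
    show "integrable lebesgue (\<lambda>x. B * k x)"
      using k by simp
    show "AE x in lebesgue. norm (k x * \<psi> x) \<le> norm (B * k x)"
    proof (rule AE_I2)
      fix x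
      have "\<bar>k x\<bar> * \<bar>\<psi> x\<bar> \<le> \<bar>k x\<bar> * \<bar>B\<bar>"
        using B[of x] \<psi>(2)[of x] by (cases "x \<in> K") (auto intro!: mult_left_mono)
      then show "norm (k x * \<psi> x) \<le> norm (B * k x)"
        by (simp add: abs_mult mult.commute)
    qed
  qed measurable
  moreover have "(\<lambda>x. k x * \<psi> x) = (\<lambda>x. indicator \<Omega> x *\<^sub>R (f x * \<psi> x))"
    using K(2) \<psi>(2) by (fastforce simp: k_def fun_eq_iff split: split_indicator)
  ultimately show ?thesis
    by (simp add: set_integrable_def)
qed

text \<open>The last property holds because \<open>\<psi>\<close> vanishes in a neighbourhood of any point outside its support.\<close>

lemma test_functionD:
  assumes "test_function \<Omega> \<psi> D\<psi>"
  shows "continuous_on UNIV \<psi>" "continuous_on UNIV (\<lambda>x. D\<psi> x $ j)"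
    "compact (closure {x. \<psi> x \<noteq> 0})" "closure {x. \<psi> x \<noteq> 0} \<subseteq> \<Omega>"
    "x \<notin> closure {x. \<psi> x \<noteq> 0} \<Longrightarrow> \<psi> x = 0" "x \<notin> closure {x. \<psi> x \<noteq> 0} \<Longrightarrow> D\<psi> x $ j = 0"
proof -
  have D: "(\<psi> has_derivative (\<lambda>h. D\<psi> x \<bullet> h)) (at x)" for x
    using assms by (simp add: test_function_def)
  show "continuous_on UNIV \<psi>"
    using has_derivative_continuous_on[OF D] .
  show "continuous_on UNIV (\<lambda>x. D\<psi> x $ j)"
    using assms unfolding test_function_def by (intro continuous_on_component) simp
  show "compact (closure {x. \<psi> x \<noteq> 0})" "closure {x. \<psi> x \<noteq> 0} \<subseteq> \<Omega>"
    using assms by (simp_all add: test_function_def)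
  show "\<psi> x = 0" if "x \<notin> closure {x. \<psi> x \<noteq> 0}"
    using that closure_subset[of "{x. \<psi> x \<noteq> 0}"] by auto
  show "D\<psi> x $ j = 0" if x: "x \<notin> closure {x. \<psi> x \<noteq> 0}"
  proof -
    have "((\<lambda>_. 0) has_derivative (\<lambda>h. D\<psi> x \<bullet> h)) (at x)"
    proof (rule has_derivative_transform_within_open[OF D])
      show "open (- closure {x. \<psi> x \<noteq> 0})" "x \<in> - closure {x. \<psi> x \<noteq> 0}"
        using x by auto
      show "\<psi> y = 0" if "y \<in> - closure {x. \<psi> x \<noteq> 0}" for y
        using that closure_subset[of "{x. \<psi> x \<noteq> 0}"] by auto
    qed
    then have "(\<lambda>h. D\<psi> x \<bullet> h) = (\<lambda>_. 0)"
      by (rule has_derivative_unique) (rule has_derivative_const)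
    from fun_cong[OF this, of "D\<psi> x"] have "D\<psi> x \<bullet> D\<psi> x = 0" .
    then show ?thesis
      by simp
  qed
qed

lemma has_weak_gradient_set_integrable:
  assumes "has_weak_gradient \<Omega> \<phi> G" "compact K" "K \<subseteq> \<Omega>"
  shows "set_integrable lebesgue K (\<lambda>x. \<phi> x $ i)" "set_integrable lebesgue K (\<lambda>x. G x $ i $ j)"
proof -
  have "set_integrable lebesgue K \<phi>" "set_integrable lebesgue K G"
    using assms by (auto simp: has_weak_gradient_def)
  then have \<phi>: "integrable lebesgue (\<lambda>x. indicator K x *\<^sub>R \<phi> x)" and
      G: "integrable lebesgue (\<lambda>x. indicator K x *\<^sub>R G x)"
    by (simp_all add: set_integrable_def)
  show "set_integrable lebesgue K (\<lambda>x. \<phi> x $ i)"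
    using integrable_bounded_linear[OF bounded_linear_vec_nth \<phi>, of i] by (simp add: set_integrable_def)
  show "set_integrable lebesgue K (\<lambda>x. G x $ i $ j)"
    using integrable_bounded_linear[OF bounded_linear_vec_nth
        integrable_bounded_linear[OF bounded_linear_vec_nth G], of i j]
    by (simp add: set_integrable_def)
qed

lemma has_weak_gradient_integrable_mult_test_function:
  assumes "has_weak_gradient \<Omega> \<phi> G" "test_function \<Omega> \<psi> D\<psi>"
  shows "set_integrable lebesgue \<Omega> (\<lambda>x. \<phi> x $ i * D\<psi> x $ j)"
    "set_integrable lebesgue \<Omega> (\<lambda>x. G x $ i $ j * \<psi> x)"
proof -
  note \<psi> = test_functionD[OF assms(2)]
  note int = has_weak_gradient_set_integrable[OF assms(1) \<psi>(3,4)]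
  show "set_integrable lebesgue \<Omega> (\<lambda>x. \<phi> x $ i * D\<psi> x $ j)"
    by (rule set_integrable_mult_compact_support[OF int(1) \<psi>(3,4,2,6)])
  show "set_integrable lebesgue \<Omega> (\<lambda>x. G x $ i $ j * \<psi> x)"
    by (rule set_integrable_mult_compact_support[OF int(2) \<psi>(3,4,1,5)])
qed

lemma has_weak_gradient_integration_by_parts:
  assumes "has_weak_gradient \<Omega> \<phi> G" "test_function \<Omega> \<psi> D\<psi>"
  shows "(LINT x:\<Omega>|lebesgue. G x $ i $ j * \<psi> x) = - (LINT x:\<Omega>|lebesgue. \<phi> x $ i * D\<psi> x $ j)"
  using assms by (simp add: has_weak_gradient_def)

text \<open>All four integrals converge because test functions and their derivatives are bounded with compact
  support; hence the defining identities can be subtracted.\<close>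

lemma has_weak_gradient_diff:
  assumes "has_weak_gradient \<Omega> \<phi> G" "has_weak_gradient \<Omega> \<phi>' G'"
  shows "has_weak_gradient \<Omega> (\<lambda>x. \<phi> x - \<phi>' x) (\<lambda>x. G x - G' x)"
  unfolding has_weak_gradient_def
proof (intro conjI allI impI)
  show "set_integrable lebesgue K (\<lambda>x. \<phi> x - \<phi>' x)" "set_integrable lebesgue K (\<lambda>x. G x - G' x)"
    if "compact K \<and> K \<subseteq> \<Omega>" for K
    using assms that by (auto simp: has_weak_gradient_def intro!: set_integral_diff)
next
  fix \<psi> D\<psi> i j
  assume \<psi>: "test_function \<Omega> \<psi> D\<psi>"
  note int = has_weak_gradient_integrable_mult_test_function[OF assms(1) \<psi>, of i j]
    has_weak_gradient_integrable_mult_test_function[OF assms(2) \<psi>, of i j]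
  have "(LINT x:\<Omega>|lebesgue. (\<phi> x - \<phi>' x) $ i * D\<psi> x $ j)
      = (LINT x:\<Omega>|lebesgue. \<phi> x $ i * D\<psi> x $ j) - (LINT x:\<Omega>|lebesgue. \<phi>' x $ i * D\<psi> x $ j)"
    using set_integral_diff(2)[OF int(1,3)] by (simp add: left_diff_distrib)
  also have "\<dots> = - ((LINT x:\<Omega>|lebesgue. G x $ i $ j * \<psi> x) - (LINT x:\<Omega>|lebesgue. G' x $ i $ j * \<psi> x))"
    by (simp add: has_weak_gradient_integration_by_parts[OF assms(1) \<psi>]
        has_weak_gradient_integration_by_parts[OF assms(2) \<psi>])
  also have "\<dots> = - (LINT x:\<Omega>|lebesgue. (G x - G' x) $ i $ j * \<psi> x)"
    using set_integral_diff(2)[OF int(2,4)] by (simp add: left_diff_distrib)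
  finally show "(LINT x:\<Omega>|lebesgue. (\<phi> x - \<phi>' x) $ i * D\<psi> x $ j)
      = - (LINT x:\<Omega>|lebesgue. (G x - G' x) $ i $ j * \<psi> x)" .
qed

lemma has_weak_gradient_unique:
  assumes \<Omega>: "open \<Omega>" and G: "has_weak_gradient \<Omega> \<phi> G" and G': "has_weak_gradient \<Omega> \<phi> G'"
  shows "AE x in lebesgue. x \<in> \<Omega> \<longrightarrow> G x = G' x"
proof -
  have "AE x in lebesgue. x \<in> \<Omega> \<longrightarrow> G x $ i $ j - G' x $ i $ j = 0" for i j
  proof (rule fundamental_lemma_calculus_of_variations[OF \<Omega>])
    show "set_integrable lebesgue K (\<lambda>x. G x $ i $ j - G' x $ i $ j)" if "compact K" "K \<subseteq> \<Omega>" for K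
      using that G G' by (intro set_integral_diff has_weak_gradient_set_integrable)
  next
    fix \<psi> D\<psi> assume \<psi>: "test_function \<Omega> \<psi> D\<psi>"
    have "(LINT x:\<Omega>|lebesgue. G x $ i $ j * \<psi> x) = (LINT x:\<Omega>|lebesgue. G' x $ i $ j * \<psi> x)"
      by (simp only: has_weak_gradient_integration_by_parts[OF G \<psi>]
          has_weak_gradient_integration_by_parts[OF G' \<psi>])
    then show "(LINT x:\<Omega>|lebesgue. (G x $ i $ j - G' x $ i $ j) * \<psi> x) = 0"
      using set_integral_diff(2)[OF has_weak_gradient_integrable_mult_test_function(2)[OF G \<psi>, of i j]
          has_weak_gradient_integrable_mult_test_function(2)[OF G' \<psi>, of i j]]
      by (simp add: left_diff_distrib)
  qed
  then have "AE x in lebesgue. \<forall>i j. x \<in> \<Omega> \<longrightarrow> G x $ i $ j - G' x $ i $ j = 0"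
    unfolding AE_all_countable by (intro allI)
  then show ?thesis
    by eventually_elim (simp add: vec_eq_iff)
qed

lemma has_weak_gradient_wgrad:
  "has_weak_gradient \<Omega> \<phi> G \<Longrightarrow> has_weak_gradient \<Omega> \<phi> (wgrad \<Omega> \<phi>)"
  unfolding wgrad_def by (rule someI[of "has_weak_gradient \<Omega> \<phi>"])

lemma wgrad_diff:
  assumes "open \<Omega>" "has_weak_gradient \<Omega> \<phi> G" "has_weak_gradient \<Omega> \<phi>' G'"
  shows "AE x in lebesgue. x \<in> \<Omega> \<longrightarrow> wgrad \<Omega> (\<lambda>x. \<phi> x - \<phi>' x) x = wgrad \<Omega> \<phi> x - wgrad \<Omega> \<phi>' x"
proof -
  have "has_weak_gradient \<Omega> (\<lambda>x. \<phi> x - \<phi>' x) (\<lambda>x. wgrad \<Omega> \<phi> x - wgrad \<Omega> \<phi>' x)"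
    using assms(2,3) by (intro has_weak_gradient_diff has_weak_gradient_wgrad)
  with assms(1) show ?thesis
    using has_weak_gradient_wgrad by (intro has_weak_gradient_unique)
qed

text \<open>Local integrability gives measurability on compact sets only; \<open>\<Omega>\<close> is exhausted by a sequence of these.\<close>

lemma has_weak_gradient_measurable:
  assumes "open \<Omega>" "has_weak_gradient \<Omega> \<phi> G"
  shows "(\<lambda>x. indicator \<Omega> x *\<^sub>R G x) \<in> borel_measurable lebesgue"
proof -
  obtain C where C: "\<And>n. compact (C n)" "\<And>n. C n \<subseteq> \<Omega>"
    "\<And>n. C n \<subseteq> interior (C (Suc n))" "\<Union>(range C) = \<Omega>"
    "\<And>K. \<lbrakk>compact K; K \<subseteq> \<Omega>\<rbrakk> \<Longrightarrow> \<exists>N. \<forall>n\<ge>N. K \<subseteq> C n"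
    by (rule open_Union_compact_subsets[OF assms(1)]) blast
  show ?thesis
  proof (rule borel_measurable_LIMSEQ_metric)
    show "(\<lambda>x. indicator (C n) x *\<^sub>R G x) \<in> borel_measurable lebesgue" for n
    proof -
      have "set_integrable lebesgue (C n) G"
        using assms(2) C(1,2)[of n] by (simp add: has_weak_gradient_def)
      then show ?thesis
        unfolding set_integrable_def by (rule borel_measurable_integrable)
    qed
    fix x :: vec3
    have "\<forall>\<^sub>F n in sequentially. indicator (C n) x = (indicator \<Omega> x :: real)"
    proof (cases "x \<in> \<Omega>")
      case True
      then obtain N where "\<forall>n\<ge>N. {x} \<subseteq> C n"
        using C(5)[of "{x}"] by auto
      with True show ?thesis
        by (auto simp: eventually_sequentially intro!: exI[of _ N])
    next
      case False
      then have "x \<notin> C n" for n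
        using C(2)[of n] by blast
      with False show ?thesis
        by simp
    qed
    then show "(\<lambda>n. indicator (C n) x *\<^sub>R G x) \<longlonglongrightarrow> indicator \<Omega> x *\<^sub>R G x"
      by (intro tendsto_eventually) (auto elim: eventually_mono)
  qed
qed

section \<open>Comparison of energies\<close>

text \<open>With positive and negative parts, \<open>f0 + p \<le> f\<close> becomes the inequality
  \<open>f0\<^sup>+ + f\<^sup>- + p\<^sup>+ \<le> f\<^sup>+ + f0\<^sup>- + p\<^sup>-\<close> between nonnegative functions. The integrals of \<open>p\<^sup>+\<close> and \<open>p\<^sup>-\<close> are finite and
  equal, so they cancel. Passing to differences in the extended reals requires in addition that
  \<open>f0\<^sup>+\<close> has a finite integral whenever \<open>f\<^sup>+\<close> does, which follows from \<open>f0\<^sup>+ \<le> f\<^sup>+ + p\<^sup>-\<close>.\<close>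

lemma extended_integral_mono:
  fixes f f0 p :: "'a \<Rightarrow> real"
  assumes [measurable]: "f \<in> borel_measurable M" "f0 \<in> borel_measurable M"
    and p: "integrable M p" "integral\<^sup>L M p = 0"
    and le: "AE x in M. f0 x + p x \<le> f x"
  shows "enn2ereal (\<integral>\<^sup>+x. ennreal (f0 x) \<partial>M) - enn2ereal (\<integral>\<^sup>+x. ennreal (- f0 x) \<partial>M)
       \<le> enn2ereal (\<integral>\<^sup>+x. ennreal (f x) \<partial>M) - enn2ereal (\<integral>\<^sup>+x. ennreal (- f x) \<partial>M)"
proof -
  have [measurable]: "p \<in> borel_measurable M"
    using p(1) by (rule borel_measurable_integrable)
  let ?I = "\<lambda>f. \<integral>\<^sup>+x. ennreal (f x) \<partial>M"
  have fin: "?I p < \<infinity>" "?I (\<lambda>x. - p x) < \<infinity>"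
    using p(1) by (simp_all add: real_integrable_def less_top[symmetric])
  have "enn2real (?I p) = enn2real (?I (\<lambda>x. - p x))"
    using real_lebesgue_integral_def[OF p(1)] p(2) by simp
  then have eq: "?I p = ?I (\<lambda>x. - p x)"
    using fin by (metis ennreal_enn2real infinity_ennreal_def)
  \<comment> \<open>makes the truncation at 0 explicit, so that sums of positive parts can be compared as real numbers\<close>
  have pos: "ennreal r = ennreal (max 0 r)" for r
    by (simp add: ennreal_max_0)
  have "?I f0 + ?I (\<lambda>x. - f x) + ?I p
      = (\<integral>\<^sup>+x. ennreal (f0 x) + ennreal (- f x) + ennreal (p x) \<partial>M)"
    by (simp add: nn_integral_add)
  also have "\<dots> \<le> (\<integral>\<^sup>+x. ennreal (f x) + ennreal (- f0 x) + ennreal (- p x) \<partial>M)"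
    by (rule nn_integral_mono_AE, use le in eventually_elim)
      (subst (1 2 3 4 5 6) pos, auto simp flip: ennreal_plus simp del: ennreal_max_0 intro!: ennreal_leI)
  also have "\<dots> = ?I f + ?I (\<lambda>x. - f0 x) + ?I (\<lambda>x. - p x)"
    by (simp add: nn_integral_add)
  finally have le_I: "?I f0 + ?I (\<lambda>x. - f x) \<le> ?I f + ?I (\<lambda>x. - f0 x)"
    using fin by (auto simp: eq ennreal_add_left_cancel_le add.commute[of _ "?I (\<lambda>x. - p x)"])
  have "?I f0 \<le> (\<integral>\<^sup>+x. ennreal (f x) + ennreal (- p x) \<partial>M)"
    by (rule nn_integral_mono_AE, use le in eventually_elim)
      (subst (1 2 3) pos, auto simp flip: ennreal_plus simp del: ennreal_max_0 intro!: ennreal_leI)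
  also have "\<dots> = ?I f + ?I (\<lambda>x. - p x)"
    by (simp add: nn_integral_add)
  finally have f0: "?I f0 < \<infinity>" if "?I f < \<infinity>"
    using that fin(2) by (auto simp: less_top[symmetric] top_unique)
  show ?thesis
  proof (cases "?I f < \<infinity>")
    case False
    then show ?thesis
      by (simp add: less_top[symmetric])
  next
    case True
    note fin = True f0[OF True]
    show ?thesis
    proof (cases "?I (\<lambda>x. - f0 x) < \<infinity>")
      case False
      then show ?thesis
        using fin by (cases "?I f0") (auto simp: less_top[symmetric])
    next
      case True
      then have "?I (\<lambda>x. - f x) < \<infinity>"
        using le_I fin by (auto simp: less_top[symmetric] top_unique)
      then show ?thesis
        using le_I fin True
        by (cases "?I f"; cases "?I f0"; cases "?I (\<lambda>x. - f x)"; cases "?I (\<lambda>x. - f0 x)")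
          (auto simp flip: ennreal_plus simp: ennreal_le_iff enn2ereal_ennreal less_top[symmetric])
    qed
  qed
qed

text \<open>Differentiability of \<open>What\<close> makes \<open>W\<close> continuous at invertible matrices but says nothing elsewhere.
  It is therefore replaced by 0 at singular matrices, which changes the integrand of the energy on a
  null set at most.\<close>

lemma energy_integrand_measurable:
  assumes diff: "What differentiable_on Sym_pos"
    and \<Omega>: "open \<Omega>" and \<phi>: "deformation \<Omega> \<phi>"
  obtains f where "f \<in> borel_measurable lebesgue"
    "AE x in lebesgue. f x = indicator \<Omega> x * W_of What (wgrad \<Omega> \<phi> x)"
proof -
  let ?U = "{F :: mat3. det F \<noteq> 0}" and ?G = "\<lambda>x. indicator \<Omega> x *\<^sub>R wgrad \<Omega> \<phi> x"
  define W' where "W' F = indicator ?U F *\<^sub>R W_of What F" for F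
  have "continuous_on ?U (W_of What)"
    by (rule has_derivative_continuous_on[OF has_derivative_at_withinI])
      (rule W_of_has_derivative[OF diff], simp)
  then have [measurable]: "W' \<in> borel_measurable borel"
    unfolding W'_def using open_det_nonzero by (intro borel_measurable_continuous_on_indicator) auto
  have [measurable]: "?G \<in> borel_measurable lebesgue"
    using \<phi> \<Omega> has_weak_gradient_wgrad unfolding deformation_def
    by (blast intro: has_weak_gradient_measurable)
  have [measurable]: "\<Omega> \<in> sets lebesgue"
    using \<Omega> by simp
  show ?thesis
  proof
    show "(\<lambda>x. indicator \<Omega> x * W' (?G x)) \<in> borel_measurable lebesgue"
      by (intro borel_measurable_times measurable_compose[OF \<open>?G \<in> _\<close> \<open>W' \<in> _\<close>]) measurable
    have "AE x in lebesgue. x \<in> \<Omega> \<longrightarrow> cauchy_green (wgrad \<Omega> \<phi> x) \<in> Sym_pos"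
      using \<phi> by (simp add: deformation_def)
    then show "AE x in lebesgue. indicator \<Omega> x * W' (?G x) = indicator \<Omega> x * W_of What (wgrad \<Omega> \<phi> x)"
      by eventually_elim (auto simp: W'_def cauchy_green_in_Sym_pos_iff split: split_indicator)
  qed
qed

lemma energy_eq:
  assumes "AE x in lebesgue. f x = indicator \<Omega> x * W_of What (wgrad \<Omega> \<phi> x)"
  shows "energy What \<Omega> \<phi> = enn2ereal (\<integral>\<^sup>+x. ennreal (f x) \<partial>lebesgue) - enn2ereal (\<integral>\<^sup>+x. ennreal (- f x) \<partial>lebesgue)"
proof -
  have "(\<integral>\<^sup>+x\<in>\<Omega>. ennreal (W_of What (wgrad \<Omega> \<phi> x)) \<partial>lebesgue) = (\<integral>\<^sup>+x. ennreal (f x) \<partial>lebesgue)"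
    by (rule nn_integral_cong_AE, use assms in eventually_elim) (simp split: split_indicator)
  moreover have "(\<integral>\<^sup>+x\<in>\<Omega>. ennreal (- W_of What (wgrad \<Omega> \<phi> x)) \<partial>lebesgue) = (\<integral>\<^sup>+x. ennreal (- f x) \<partial>lebesgue)"
    by (rule nn_integral_cong_AE, use assms in eventually_elim) (simp split: split_indicator)
  ultimately show ?thesis
    by (simp add: energy_def)
qed

theorem proposition2p1:
  fixes \<Omega> \<Gamma> :: "(real ^ 3) set"
    and V :: "(real ^ 3 \<Rightarrow> real ^ 3) set"
    and g \<phi>\<^sub>0 :: "real ^ 3 \<Rightarrow> real ^ 3"
    and What :: "real ^ 3 ^ 3 \<Rightarrow> real"
  assumes "open \<Omega>" and "\<Gamma> \<subseteq> frontier \<Omega>"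
    and "What differentiable_on Sym_pos"
    and "convex_on Sym_pos What"
    and "weak_solution What V \<Omega> \<Gamma> g \<phi>\<^sub>0"
    and "AE x in lebesgue. x \<in> \<Omega> \<longrightarrow> piola2 What (cauchy_green (wgrad \<Omega> \<phi>\<^sub>0 x)) \<in> Sym_pos"
  shows "global_minimizer What V \<Omega> \<Gamma> g \<phi>\<^sub>0"
proof -
  have comp0: "\<phi>\<^sub>0 \<in> competing V \<Omega> \<Gamma> g"
    using assms(5) by (simp add: weak_solution_def)
  then have def0: "deformation \<Omega> \<phi>\<^sub>0"
    by (simp add: competing_def)
  have "energy What \<Omega> \<phi>\<^sub>0 \<le> energy What \<Omega> \<phi>" if comp: "\<phi> \<in> competing V \<Omega> \<Gamma> g" for \<phi>
  proof -
    have "deformation \<Omega> \<phi>"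
      using comp by (simp add: competing_def)
    obtain f where f: "f \<in> borel_measurable lebesgue"
      "AE x in lebesgue. f x = indicator \<Omega> x * W_of What (wgrad \<Omega> \<phi> x)"
      using energy_integrand_measurable[OF assms(3,1) \<open>deformation \<Omega> \<phi>\<close>] .
    obtain f0 where f0: "f0 \<in> borel_measurable lebesgue"
      "AE x in lebesgue. f0 x = indicator \<Omega> x * W_of What (wgrad \<Omega> \<phi>\<^sub>0 x)"
      using energy_integrand_measurable[OF assms(3,1) def0] .
    define u where "u = (\<lambda>x. \<phi> x - \<phi>\<^sub>0 x)"
    define p where "p x = indicator \<Omega> x *\<^sub>R (piola1 What (wgrad \<Omega> \<phi>\<^sub>0 x) \<bullet> wgrad \<Omega> u x)" for x
    have p: "integrable lebesgue p" "integral\<^sup>L lebesgue p = 0"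
      using assms(5) comp
      by (simp_all add: weak_solution_def Let_def u_def p_def[abs_def] set_integrable_def set_lebesgue_integral_def)
    have "AE x in lebesgue. x \<in> \<Omega> \<longrightarrow> wgrad \<Omega> u x = wgrad \<Omega> \<phi> x - wgrad \<Omega> \<phi>\<^sub>0 x"
      using \<open>deformation \<Omega> \<phi>\<close> def0 assms(1) unfolding deformation_def u_def by (blast intro: wgrad_diff)
    moreover have "AE x in lebesgue. x \<in> \<Omega> \<longrightarrow> cauchy_green (wgrad \<Omega> \<phi> x) \<in> Sym_pos"
      "AE x in lebesgue. x \<in> \<Omega> \<longrightarrow> cauchy_green (wgrad \<Omega> \<phi>\<^sub>0 x) \<in> Sym_pos"
      using \<open>deformation \<Omega> \<phi>\<close> def0 by (simp_all add: deformation_def)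
    ultimately have "AE x in lebesgue. f0 x + p x \<le> f x"
      using f(2) f0(2) assms(6)
    proof eventually_elim
      case (elim x)
      then show ?case
        using W_of_above_tangent[OF assms(3,4), of "wgrad \<Omega> \<phi> x" "wgrad \<Omega> \<phi>\<^sub>0 x"]
        by (cases "x \<in> \<Omega>") (simp_all add: p_def cauchy_green_in_Sym_pos_iff)
    qed
    from extended_integral_mono[OF f(1) f0(1) p this] show ?thesis
      by (simp only: energy_eq[OF f(2)] energy_eq[OF f0(2)])
  qed
  with comp0 show ?thesis
    by (simp add: global_minimizer_def)
qed

end
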